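(* Let $\lambda_i\ne\lambda_j$ be two eigenvalues. On the two-eigenvalue face of the simplex (supported on $\lambda_i,\lambda_j$), the imbalance $s=p_i-p_j$ satisfies, along the residual flow, \[ \dot s=2\Delta_{ij}^2s(1-s^2). \] Let $\gamma_{ij}=2\Delta_{ij}^2$. Fix an escape threshold $0<s_*<1$. If $0<|s_0|<s_*$, where $s_0=s(0)$, the time needed to reach $|s(t)|=s_*$ is \[ T_{\rm esc}(s_0)=\frac1{2\gamma_{ij}}\log\left(\frac{s_*^2(1-s_0^2)}{s_0^2(1-s_*^2)}\right). \] In particular, as $s_0\to0$, \[ T_{\rm esc}(s_0)=\frac1{\gamma_{ij}}\log\frac1{|s_0|}+O(1). \]
   Context: $A=\operatorname{diag}(\lambda_1,\dots,\lambda_n)$ is normal, and the residual flow on the simplex $\{p_k\ge0,\sum_kp_k=1\}$ is $\dot p_k=4p_k(\rho(p)-|\lambda_k-z(p)|^2)$ with $z(p)=\sum_lp_l\lambda_l$, $\rho(p)=\sum_lp_l|\lambda_l-z(p)|^2$. The two-eigenvalue face is the (invariant) set of $p$ with $p_k=0$ for $k\ne i,j$, so that $p_i+p_j=1$ and $s=\frac{p_i-p_j}{p_i+p_j}=p_i-p_j$. Put $\Delta_{ij}=|\lambda_i-\lambda_j|$. *)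

theory Defs
  imports "HOL-Analysis.Analysis" "HOL-Library.Landau_Symbols"
begin

text \<open>The eigenvalues of the normal matrix \<open>A\<close> (diagonal, with possible repetitions) are the
  entries of \<open>lam\<close>; the residual flow depends on \<open>A\<close> only through them.\<close>

definition prob_simplex :: "(real ^ 'n) set" where
  "prob_simplex = {p. (\<forall>k. 0 \<le> p $ k) \<and> (\<Sum>k\<in>UNIV. p $ k) = 1}"

definition mean_eig :: "complex ^ 'n \<Rightarrow> real ^ 'n \<Rightarrow> complex" where
  "mean_eig lam p = (\<Sum>l\<in>UNIV. of_real (p $ l) * lam $ l)"

definition var_eig :: "complex ^ 'n \<Rightarrow> real ^ 'n \<Rightarrow> real" where
  "var_eig lam p = (\<Sum>l\<in>UNIV. p $ l * (cmod (lam $ l - mean_eig lam p))\<^sup>2)"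

definition residual_field :: "complex ^ 'n \<Rightarrow> real ^ 'n \<Rightarrow> real ^ 'n" where
  "residual_field lam p =
     (\<chi> k. 4 * p $ k * (var_eig lam p - (cmod (lam $ k - mean_eig lam p))\<^sup>2))"

text \<open>Forward trajectories; the derivative at time \<open>0\<close> is one-sided.\<close>

definition residual_trajectory :: "complex ^ 'n \<Rightarrow> (real \<Rightarrow> real ^ 'n) \<Rightarrow> bool" where
  "residual_trajectory lam p \<longleftrightarrow>
     (\<forall>t\<ge>0. p t \<in> prob_simplex \<and>
        (p has_vector_derivative residual_field lam (p t)) (at t within {0..}))"

definition two_face :: "'n \<Rightarrow> 'n \<Rightarrow> (real ^ 'n) set" where
  "two_face i j = {p \<in> prob_simplex. \<forall>k. k \<noteq> i \<and> k \<noteq> j \<longrightarrow> p $ k = 0}"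

definition imbalance :: "'n \<Rightarrow> 'n \<Rightarrow> real ^ 'n \<Rightarrow> real" where
  "imbalance i j p = p $ i - p $ j"

definition eig_gap :: "complex ^ 'n \<Rightarrow> 'n \<Rightarrow> 'n \<Rightarrow> real" where
  "eig_gap lam i j = cmod (lam $ i - lam $ j)"

definition escape_rate :: "complex ^ 'n \<Rightarrow> 'n \<Rightarrow> 'n \<Rightarrow> real" where
  "escape_rate lam i j = 2 * (eig_gap lam i j)\<^sup>2"

definition face_trajectory ::
  "complex ^ 'n \<Rightarrow> 'n \<Rightarrow> 'n \<Rightarrow> real \<Rightarrow> (real \<Rightarrow> real ^ 'n) \<Rightarrow> bool" where
  "face_trajectory lam i j s0 p \<longleftrightarrow>
     residual_trajectory lam p \<and> p 0 \<in> two_face i j \<and> imbalance i j (p 0) = s0"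

definition first_reach_time :: "(real \<Rightarrow> real) \<Rightarrow> real \<Rightarrow> real \<Rightarrow> bool" where
  "first_reach_time f c T \<longleftrightarrow> 0 \<le> T \<and> f T = c \<and> (\<forall>t. 0 \<le> t \<and> t < T \<longrightarrow> f t \<noteq> c)"

text \<open>A point of the two-eigenvalue face is determined by its imbalance, so the escape time is a
  function of \<open>s0\<close> alone.\<close>

definition escape_time :: "complex ^ 'n \<Rightarrow> 'n \<Rightarrow> 'n \<Rightarrow> real \<Rightarrow> real \<Rightarrow> real" where
  "escape_time lam i j sstar s0 =
     (THE T. \<exists>p. face_trajectory lam i j s0 p \<and>
        first_reach_time (\<lambda>t. \<bar>imbalance i j (p t)\<bar>) sstar T)"

end

theory Submission
  imports Defs
begin

text \<open>
  On the face spanned by \<open>i\<close> and \<open>j\<close> the whole state is the number \<open>s = p_i - p_j\<close>, with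
  \<open>p_i p_j = (1 - s\<^sup>2) / 4\<close>.  The deviations from the mean are \<open>p_j\<close> and \<open>p_i\<close> times the gap, so the
  variance is \<open>p_i p_j\<close> times the squared gap, and the residual field becomes the scalar
  equation \<open>s' = \<gamma> s (1 - s\<^sup>2)\<close> along the edge direction (\<open>residual_field_on_face\<close>).  A trajectory
  starting on the face stays there (\<open>two_face_invariant\<close>), because each coordinate satisfies
  \<open>p_k' \<le> C p_k\<close> and hence cannot leave zero.

  The square \<open>u = s\<^sup>2\<close> satisfies the logistic equation \<open>u' = 2 \<gamma> u (1 - u)\<close>, whose odds
  \<open>u / (1 - u)\<close> grow exactly like \<open>exp (2 \<gamma> t)\<close> (\<open>odds_growth\<close>).  The
  modulus \<open>\<bar>s\<bar>\<close> therefore equals the threshold at exactly one time, the one at which the odds have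
  grown from \<open>s0\<^sup>2 / (1 - s0\<^sup>2)\<close> to those of the threshold (\<open>reaches_threshold_iff\<close>).  This
  determines the hitting time of every trajectory at once; an explicit solution
  (\<open>face_trajectory_exists\<close>) shows that there is one.  Finally the logarithm splits into
  \<open>2 ln (1 / \<bar>s0\<bar>)\<close> and terms that stay bounded as \<open>s0\<close> tends to zero.
\<close>

section \<open>A differential inequality\<close>

text \<open>The special case of Gronwall's inequality with zero initial value: \<open>y t * exp (- C t)\<close> is
  nonincreasing and starts at zero.  It gives both the invariance of the face and, applied to the
  square of a defect, the uniqueness of the solution.\<close>

lemma nonneg_zero_if_deriv_le:
  fixes y y' :: "real \<Rightarrow> real"
  assumes deriv: "\<And>t. 0 \<le> t \<Longrightarrow> (y has_real_derivative y' t) (at t within {0..})"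
    and le: "\<And>t. 0 \<le> t \<Longrightarrow> y' t \<le> C * y t"
    and nonneg: "\<And>t. 0 \<le> t \<Longrightarrow> 0 \<le> y t"
    and zero: "y 0 = 0" and t: "0 \<le> t"
  shows "y t = 0"
proof -
  define h where "h = (\<lambda>t. y t * exp (- C * t))"
  have h_deriv: "(h has_real_derivative (y' x - C * y x) * exp (- C * x)) (at x within {0..})"
    if "0 \<le> x" for x
    unfolding h_def by (auto intro!: derivative_eq_intros deriv that simp: algebra_simps)
  have "continuous_on {0..} h"
    by (rule DERIV_continuous_on) (use h_deriv in auto)
  then have cont: "continuous_on {0..t} h"
    by (rule continuous_on_subset) auto
  have "h t \<le> h 0"
  proof (rule DERIV_nonpos_imp_decreasing_open[OF t _ cont])
    fix x assume x: "0 < x" "x < t"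
    then have "at x within {0..} = at x"
      by (intro at_within_interior) auto
    moreover have "(y' x - C * y x) * exp (- C * x) \<le> 0"
      using le[of x] x by (intro mult_nonpos_nonneg) auto
    ultimately show "\<exists>d. (h has_real_derivative d) (at x) \<and> d \<le> 0"
      using h_deriv[of x] x by auto
  qed
  then have "y t \<le> 0"
    using zero by (simp add: h_def mult_le_0_iff)
  then show ?thesis
    using nonneg[OF t] by simp
qed

section \<open>Invariance of the two-eigenvalue face\<close>

lemma mean_eig_norm_le:
  assumes "p \<in> prob_simplex"
  shows "cmod (mean_eig lam p) \<le> (\<Sum>l\<in>UNIV. cmod (lam $ l))"
proof -
  have p: "0 \<le> p $ l" "p $ l \<le> 1" for l
    using assms member_le_sum[of l UNIV "\<lambda>l. p $ l"] by (auto simp: prob_simplex_def)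
  have "cmod (of_real (p $ l) * lam $ l) \<le> cmod (lam $ l)" for l
    using p[of l] by (simp add: norm_mult mult_left_le_one_le)
  then show ?thesis
    unfolding mean_eig_def by (intro sum_norm_le) auto
qed

text \<open>The constant is crude: each deviation from the mean is at most twice the sum of
  the moduli of the eigenvalues.\<close>

lemma var_eig_le:
  assumes "p \<in> prob_simplex"
  shows "var_eig lam p \<le> (2 * (\<Sum>l\<in>UNIV. cmod (lam $ l)))\<^sup>2"
proof -
  let ?L = "\<Sum>l\<in>UNIV. cmod (lam $ l)"
  have dev: "cmod (lam $ l - mean_eig lam p) \<le> 2 * ?L" for l
    using norm_triangle_ineq4[of "lam $ l" "mean_eig lam p"] mean_eig_norm_le[OF assms, of lam]
      member_le_sum[of l UNIV "\<lambda>l. cmod (lam $ l)"] by auto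
  have "var_eig lam p \<le> (\<Sum>l\<in>UNIV. p $ l * (2 * ?L)\<^sup>2)"
    unfolding var_eig_def
    by (intro sum_mono mult_left_mono power_mono dev) (use assms in \<open>auto simp: prob_simplex_def\<close>)
  also have "\<dots> = (2 * ?L)\<^sup>2"
    using assms by (simp add: prob_simplex_def flip: sum_distrib_right)
  finally show ?thesis .
qed

lemma two_face_invariant:
  assumes traj: "residual_trajectory lam p" and start: "p 0 \<in> two_face i j" and t: "0 \<le> t"
  shows "p t \<in> two_face i j"
proof -
  let ?C = "4 * (2 * (\<Sum>l\<in>UNIV. cmod (lam $ l)))\<^sup>2"
  have simplex: "p t \<in> prob_simplex" if "0 \<le> t" for t
    using traj that by (auto simp: residual_trajectory_def)
  have "p t $ k = 0" if "k \<noteq> i" "k \<noteq> j" for k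
  proof (rule nonneg_zero_if_deriv_le[where y = "\<lambda>t. p t $ k"
        and y' = "\<lambda>t. residual_field lam (p t) $ k" and C = ?C])
    fix t :: real assume t: "0 \<le> t"
    show nonneg: "0 \<le> p t $ k"
      using simplex[OF t] by (simp add: prob_simplex_def)
    show "((\<lambda>t. p t $ k) has_real_derivative residual_field lam (p t) $ k) (at t within {0..})"
      using traj t bounded_linear.has_vector_derivative[OF bounded_linear_vec_nth]
      unfolding residual_trajectory_def has_real_derivative_iff_has_vector_derivative by blast
    have "var_eig lam (p t) - (cmod (lam $ k - mean_eig lam (p t)))\<^sup>2
        \<le> (2 * (\<Sum>l\<in>UNIV. cmod (lam $ l)))\<^sup>2"
      using var_eig_le[OF simplex[OF t], of lam]
        zero_le_power2[of "cmod (lam $ k - mean_eig lam (p t))"] by linarith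
    from mult_left_mono[OF this, of "4 * p t $ k"]
    show "residual_field lam (p t) $ k \<le> ?C * p t $ k"
      using nonneg by (simp add: residual_field_def mult_ac)
  next
    show "p 0 $ k = 0"
      using start that by (simp add: two_face_def)
  qed (rule t)
  then show ?thesis
    using simplex[OF t] by (simp add: two_face_def)
qed

section \<open>The residual field on the face\<close>

lemma sum_supported_on_pair:
  fixes g :: "'n::finite \<Rightarrow> 'a::comm_monoid_add"
  assumes "i \<noteq> j" "\<And>k. k \<noteq> i \<Longrightarrow> k \<noteq> j \<Longrightarrow> g k = 0"
  shows "(\<Sum>k\<in>UNIV. g k) = g i + g j"
proof -
  have "(\<Sum>k\<in>UNIV. g k) = (\<Sum>k\<in>{i, j}. g k)"
    by (rule sum.mono_neutral_right) (use assms in auto)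
  then show ?thesis
    using assms(1) by simp
qed

lemma two_face_coordinates:
  assumes "p \<in> two_face i j" "i \<noteq> j"
  shows "p $ i = (1 + imbalance i j p) / 2" "p $ j = (1 - imbalance i j p) / 2"
    and "\<bar>imbalance i j p\<bar> \<le> 1"
proof -
  have "(\<Sum>k\<in>UNIV. p $ k) = p $ i + p $ j"
    using assms by (intro sum_supported_on_pair) (auto simp: two_face_def)
  then have sum: "p $ i + p $ j = 1" and pos: "0 \<le> p $ i" "0 \<le> p $ j"
    using assms(1) by (auto simp: two_face_def prob_simplex_def)
  show "p $ i = (1 + imbalance i j p) / 2" "p $ j = (1 - imbalance i j p) / 2"
      "\<bar>imbalance i j p\<bar> \<le> 1"
    using sum pos by (auto simp: imbalance_def field_simps)
qed

text \<open>The edge direction has imbalance one, so the scalar factor is the speed of the imbalance.\<close>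

lemma residual_field_on_face:
  assumes face: "p \<in> two_face i j" and "i \<noteq> j"
  defines "s \<equiv> imbalance i j p"
  shows "residual_field lam p =
    (escape_rate lam i j * s * (1 - s\<^sup>2)) *\<^sub>R ((1/2) *\<^sub>R (axis i 1 - axis j 1))"
proof -
  note c = two_face_coordinates(1,2)[OF face \<open>i \<noteq> j\<close>, folded s_def]
  have off: "p $ k = 0" if "k \<noteq> i" "k \<noteq> j" for k
    using face that by (simp add: two_face_def)
  have mean: "mean_eig lam p = of_real (p $ i) * lam $ i + of_real (p $ j) * lam $ j"
    unfolding mean_eig_def using \<open>i \<noteq> j\<close> off by (intro sum_supported_on_pair) auto
  have "lam $ i - mean_eig lam p = of_real ((1 - s) / 2) * (lam $ i - lam $ j)"
    unfolding mean c by (simp add: field_simps)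
  then have dev_i: "(cmod (lam $ i - mean_eig lam p))\<^sup>2 = ((1 - s) / 2)\<^sup>2 * (eig_gap lam i j)\<^sup>2"
    by (simp only: norm_mult norm_of_real power_mult_distrib power2_abs eig_gap_def)
  have "lam $ j - mean_eig lam p = of_real (- ((1 + s) / 2)) * (lam $ i - lam $ j)"
    unfolding mean c by (simp add: field_simps)
  then have dev_j: "(cmod (lam $ j - mean_eig lam p))\<^sup>2 = ((1 + s) / 2)\<^sup>2 * (eig_gap lam i j)\<^sup>2"
    by (simp only: norm_mult norm_of_real power_mult_distrib power2_abs eig_gap_def power2_minus)
  have "var_eig lam p = p $ i * (cmod (lam $ i - mean_eig lam p))\<^sup>2
      + p $ j * (cmod (lam $ j - mean_eig lam p))\<^sup>2"
    unfolding var_eig_def using \<open>i \<noteq> j\<close> off by (intro sum_supported_on_pair) auto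
  then have var: "var_eig lam p = (1 - s\<^sup>2) / 4 * (eig_gap lam i j)\<^sup>2"
    unfolding dev_i dev_j c by (simp add: field_simps power2_eq_square)
  have "residual_field lam p $ i = escape_rate lam i j * s * (1 - s\<^sup>2) / 2"
    unfolding residual_field_def vec_lambda_beta var dev_i c escape_rate_def
    by (simp add: field_simps power2_eq_square)
  moreover have "residual_field lam p $ j = - (escape_rate lam i j * s * (1 - s\<^sup>2) / 2)"
    unfolding residual_field_def vec_lambda_beta var dev_j c escape_rate_def
    by (simp add: field_simps power2_eq_square)
  moreover have "residual_field lam p $ k = 0" if "k \<noteq> i" "k \<noteq> j" for k
    using off[OF that] by (simp add: residual_field_def)
  ultimately show ?thesis
    using \<open>i \<noteq> j\<close> by (auto simp: vec_eq_iff axis_def)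
qed

lemma imbalance_deriv:
  assumes traj: "residual_trajectory lam p" and start: "p 0 \<in> two_face i j"
    and "i \<noteq> j" and t: "0 \<le> t"
  shows "((\<lambda>t. imbalance i j (p t)) has_real_derivative
    escape_rate lam i j * imbalance i j (p t) * (1 - (imbalance i j (p t))\<^sup>2)) (at t within {0..})"
proof -
  have "(p has_vector_derivative residual_field lam (p t)) (at t within {0..})"
    using traj t by (simp add: residual_trajectory_def)
  then have "((\<lambda>t. p t $ k) has_real_derivative residual_field lam (p t) $ k) (at t within {0..})"
    for k
    unfolding has_real_derivative_iff_has_vector_derivative
    by (rule bounded_linear.has_vector_derivative[OF bounded_linear_vec_nth])
  then have "((\<lambda>t. imbalance i j (p t)) has_real_derivative
      residual_field lam (p t) $ i - residual_field lam (p t) $ j) (at t within {0..})"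
    unfolding imbalance_def by (intro DERIV_diff)
  then show ?thesis
    using \<open>i \<noteq> j\<close>
    by (simp add: residual_field_on_face[OF two_face_invariant[OF traj start t] \<open>i \<noteq> j\<close>] axis_def
        mult.assoc)
qed

section \<open>Escape from the unstable equilibrium\<close>

text \<open>Integrating the equation by separation would require \<open>0 < s\<^sup>2 < 1\<close> along the whole
  solution.  Instead, the cross-multiplied defect \<open>G\<close> of the odds law is shown to solve the linear
  equation \<open>G' = 2 g (1 - s\<^sup>2) G\<close> with zero initial value, so it vanishes.\<close>

lemma odds_growth:
  fixes s :: "real \<Rightarrow> real"
  assumes deriv: "\<And>t. 0 \<le> t \<Longrightarrow>
      (s has_real_derivative g * s t * (1 - (s t)\<^sup>2)) (at t within {0..})"
    and g: "0 \<le> g" and t: "0 \<le> t"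
  shows "(s t)\<^sup>2 * (1 - (s 0)\<^sup>2) = (s 0)\<^sup>2 * exp (2 * g * t) * (1 - (s t)\<^sup>2)"
proof -
  define G where "G = (\<lambda>t. (s t)\<^sup>2 * (1 - (s 0)\<^sup>2) - (s 0)\<^sup>2 * exp (2 * g * t) * (1 - (s t)\<^sup>2))"
  have G_deriv: "(G has_real_derivative 2 * g * (1 - (s t)\<^sup>2) * G t) (at t within {0..})"
    if "0 \<le> t" for t
    unfolding G_def
    by (rule derivative_eq_intros deriv[OF that] refl)+ (simp add: algebra_simps power2_eq_square)
  have "(G t)\<^sup>2 = 0"
  proof (rule nonneg_zero_if_deriv_le[where y = "\<lambda>t. (G t)\<^sup>2"
        and y' = "\<lambda>t. 2 * (2 * g * (1 - (s t)\<^sup>2) * G t) * G t" and C = "4 * g"])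
    fix t :: real assume "0 \<le> t"
    show "((\<lambda>t. (G t)\<^sup>2) has_real_derivative 2 * (2 * g * (1 - (s t)\<^sup>2) * G t) * G t)
        (at t within {0..})"
      by (rule derivative_eq_intros G_deriv[OF \<open>0 \<le> t\<close>] refl)+ simp
    have "0 \<le> 4 * g * (s t)\<^sup>2 * (G t)\<^sup>2"
      using g by simp
    then show "2 * (2 * g * (1 - (s t)\<^sup>2) * G t) * G t \<le> 4 * g * (G t)\<^sup>2"
      by (simp add: algebra_simps power2_eq_square)
  qed (use t in \<open>auto simp: G_def\<close>)
  then show ?thesis
    by (simp add: G_def)
qed

lemma reaches_threshold_iff:
  fixes s0 u c g t :: real
  assumes odds: "u\<^sup>2 * (1 - s0\<^sup>2) = s0\<^sup>2 * exp (2 * g * t) * (1 - u\<^sup>2)"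
    and s0: "s0 \<noteq> 0" "\<bar>s0\<bar> < 1" and c: "0 < c" "c < 1" and g: "0 < g"
  shows "\<bar>u\<bar> = c \<longleftrightarrow> t = 1 / (2 * g) * ln (c\<^sup>2 * (1 - s0\<^sup>2) / (s0\<^sup>2 * (1 - c\<^sup>2)))"
    (is "_ \<longleftrightarrow> t = 1 / (2 * g) * ln ?R")
proof -
  have pos: "0 < s0\<^sup>2" "s0\<^sup>2 < 1" "0 < c\<^sup>2" "c\<^sup>2 < 1"
    using s0 c by (auto simp: abs_square_less_1 power_less_one_iff)
  then have R: "0 < ?R"
    by simp
  let ?E = "s0\<^sup>2 * exp (2 * g * t)"
  have coeff: "1 - s0\<^sup>2 + ?E \<noteq> 0"
    using pos add_pos_pos[of "1 - s0\<^sup>2" ?E] by simp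
  have "\<bar>u\<bar> = c \<longleftrightarrow> u\<^sup>2 = c\<^sup>2"
    using c by (auto simp: power2_eq_iff abs_if)
  \<comment> \<open>the odds equation determines \<open>u\<^sup>2\<close>: its coefficient \<open>1 - s0\<^sup>2 + ?E\<close> is positive\<close>
  also have "\<dots> \<longleftrightarrow> u\<^sup>2 * (1 - s0\<^sup>2 + ?E) = c\<^sup>2 * (1 - s0\<^sup>2 + ?E)"
    using coeff by simp
  also have "\<dots> \<longleftrightarrow> exp (2 * g * t) * (s0\<^sup>2 * (1 - c\<^sup>2)) = c\<^sup>2 * (1 - s0\<^sup>2)"
    using odds by (auto simp: algebra_simps)
  also have "\<dots> \<longleftrightarrow> exp (2 * g * t) = ?R"
    using pos by (simp add: nonzero_eq_divide_eq)
  also have "\<dots> \<longleftrightarrow> 2 * g * t = ln ?R"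
    using R by (metis exp_ln ln_exp)
  also have "\<dots> \<longleftrightarrow> t = 1 / (2 * g) * ln ?R"
    using g by (auto simp: field_simps)
  finally show ?thesis .
qed

text \<open>The witness solves the odds law for \<open>s\<close>:
  \<open>s t = s0 * exp (g t) / sqrt (1 - s0\<^sup>2 + s0\<^sup>2 * exp (2 g t))\<close>.  Written with \<open>exp (- g t)\<close> the numerator becomes constant.\<close>

lemma imbalance_solution_exists:
  fixes s0 g :: real
  assumes s0: "\<bar>s0\<bar> < 1"
  obtains s :: "real \<Rightarrow> real" where "s 0 = s0" "\<And>t. \<bar>s t\<bar> \<le> 1"
    "\<And>t. (s has_real_derivative g * s t * (1 - (s t)\<^sup>2)) (at t)"
proof
  define q where "q = (\<lambda>t. s0\<^sup>2 + (1 - s0\<^sup>2) * (exp (- g * t))\<^sup>2)"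
  define s where "s = (\<lambda>t. s0 / sqrt (q t))"
  have sq: "s0\<^sup>2 < 1"
    using s0 by (simp add: abs_square_less_1)
  have q: "0 < q t" "s0\<^sup>2 \<le> q t" for t
    using sq by (auto simp: q_def intro!: add_nonneg_pos)
  have s_sq: "(s t)\<^sup>2 = s0\<^sup>2 / q t" for t
    using q(1)[of t] by (simp add: s_def power_divide)
  show "s 0 = s0"
    by (simp add: s_def q_def)
  show "\<bar>s t\<bar> \<le> 1" for t
    using q[of t] s_sq[of t] by (simp flip: abs_square_le_1)
  show "(s has_real_derivative g * s t * (1 - (s t)\<^sup>2)) (at t)" for t
  proof -
    have q_deriv: "(q has_real_derivative - 2 * g * (q t - s0\<^sup>2)) (at t)"
      unfolding q_def
      by (rule derivative_eq_intros refl)+ (simp add: algebra_simps power2_eq_square)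
    have "(s has_real_derivative
        - (s0 * (- 2 * g * (q t - s0\<^sup>2) * (inverse (sqrt (q t)) / 2))) / (sqrt (q t))\<^sup>2) (at t)"
      unfolding s_def using q(1)[of t]
      by (auto intro!: derivative_eq_intros q_deriv simp: power2_eq_square)
    also have "- (s0 * (- 2 * g * (q t - s0\<^sup>2) * (inverse (sqrt (q t)) / 2))) / (sqrt (q t))\<^sup>2
        = g * s t * (1 - (s t)\<^sup>2)"
      using q(1)[of t] unfolding s_sq by (simp add: s_def field_simps)
    finally show ?thesis .
  qed
qed

lemma face_trajectory_exists:
  fixes lam :: "complex ^ 'n"
  assumes "i \<noteq> j" and s0: "\<bar>s0\<bar> < 1"
  shows "\<exists>p. face_trajectory lam i j s0 p"
proof -
  obtain s :: "real \<Rightarrow> real" where init: "s 0 = s0" and bound: "\<And>t. \<bar>s t\<bar> \<le> 1"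
    and deriv: "\<And>t. (s has_real_derivative escape_rate lam i j * s t * (1 - (s t)\<^sup>2)) (at t)"
    using imbalance_solution_exists[OF s0] by metis
  define p :: "real \<Rightarrow> real ^ 'n" where
    "p = (\<lambda>t. (1/2) *\<^sub>R (axis i 1 + axis j 1) + s t *\<^sub>R ((1/2) *\<^sub>R (axis i 1 - axis j 1)))"
  have coord: "p t $ k = (if k = i then (1 + s t) / 2 else if k = j then (1 - s t) / 2 else 0)"
    for t k
    using \<open>i \<noteq> j\<close> by (auto simp: p_def axis_def field_simps)
  have "(\<Sum>k\<in>UNIV. p t $ k) = p t $ i + p t $ j" for t
    using \<open>i \<noteq> j\<close> by (intro sum_supported_on_pair) (auto simp: coord)
  then have face: "p t \<in> two_face i j" for t
    using bound[of t] \<open>i \<noteq> j\<close>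
    by (auto simp: two_face_def prob_simplex_def coord abs_le_iff field_simps)
  have imb: "imbalance i j (p t) = s t" for t
    using \<open>i \<noteq> j\<close> by (simp add: imbalance_def coord field_simps)
  have "(p has_vector_derivative residual_field lam (p t)) (at t within {0..})" for t
  proof -
    have "(s has_real_derivative escape_rate lam i j * s t * (1 - (s t)\<^sup>2)) (at t within {0..})"
      using deriv by (rule has_field_derivative_at_within)
    then show ?thesis
      unfolding residual_field_on_face[OF face \<open>i \<noteq> j\<close>] imb
      by (subst p_def) (auto intro!: derivative_eq_intros)
  qed
  then have "face_trajectory lam i j s0 p"
    using face imb init
    by (auto simp: face_trajectory_def residual_trajectory_def two_face_def)
  then show ?thesis
    by blast
qed

text \<open>Since the threshold is met at no other time, the first hitting time is the only one, and it is
  common to all trajectories with the given initial imbalance.\<close>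

lemma first_reach_time_iff:
  assumes "lam $ i \<noteq> lam $ j" and traj: "face_trajectory lam i j s0 p"
    and s0: "0 < \<bar>s0\<bar>" "\<bar>s0\<bar> < c" and c: "c < 1"
  shows "first_reach_time (\<lambda>t. \<bar>imbalance i j (p t)\<bar>) c T \<longleftrightarrow>
    T = 1 / (2 * escape_rate lam i j) * ln (c\<^sup>2 * (1 - s0\<^sup>2) / (s0\<^sup>2 * (1 - c\<^sup>2)))"
    (is "_ \<longleftrightarrow> T = ?T")
proof -
  have "i \<noteq> j"
    using assms(1) by auto
  have rate: "0 < escape_rate lam i j"
    using assms(1) by (simp add: escape_rate_def eig_gap_def)
  have p: "residual_trajectory lam p" "p 0 \<in> two_face i j" and init: "imbalance i j (p 0) = s0"
    using traj by (auto simp: face_trajectory_def)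
  have hits: "\<bar>imbalance i j (p t)\<bar> = c \<longleftrightarrow> t = ?T" if "0 \<le> t" for t
  proof (rule reaches_threshold_iff)
    show "(imbalance i j (p t))\<^sup>2 * (1 - s0\<^sup>2) =
        s0\<^sup>2 * exp (2 * escape_rate lam i j * t) * (1 - (imbalance i j (p t))\<^sup>2)"
      using odds_growth[OF imbalance_deriv[OF p \<open>i \<noteq> j\<close>] less_imp_le[OF rate] that]
      by (simp add: init)
  qed (use s0 c rate in auto)
  have "0 \<le> ?T"
  proof -
    have lt: "s0\<^sup>2 < c\<^sup>2"
      using power_strict_mono[OF s0(2), of 2] by simp
    have pos: "0 < s0\<^sup>2" "c\<^sup>2 < 1"
      using s0 c by (auto simp: power_less_one_iff)
    have "s0\<^sup>2 * (1 - c\<^sup>2) \<le> c\<^sup>2 * (1 - s0\<^sup>2)"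
      using lt by (simp add: algebra_simps)
    then have "1 \<le> c\<^sup>2 * (1 - s0\<^sup>2) / (s0\<^sup>2 * (1 - c\<^sup>2))"
      using pos by simp
    then show ?thesis
      using rate by (intro mult_nonneg_nonneg ln_ge_zero) auto
  qed
  then show ?thesis
    using hits by (auto simp: first_reach_time_def)
qed

lemma escape_time_eq:
  assumes "lam $ i \<noteq> lam $ j" "0 < \<bar>s0\<bar>" "\<bar>s0\<bar> < c" "c < 1"
  shows "escape_time lam i j c s0 =
    1 / (2 * escape_rate lam i j) * ln (c\<^sup>2 * (1 - s0\<^sup>2) / (s0\<^sup>2 * (1 - c\<^sup>2)))"
proof -
  have "\<exists>p. face_trajectory lam i j s0 p"
    using assms by (intro face_trajectory_exists) auto
  then show ?thesis
    unfolding escape_time_def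
    by (intro the_equality) (use first_reach_time_iff[OF assms(1) _ assms(2-4)] in auto)
qed

lemma escape_time_asymptotics:
  assumes "lam $ i \<noteq> lam $ j" "0 < c" "c < 1"
  shows "(\<lambda>s0. escape_time lam i j c s0 - 1 / escape_rate lam i j * ln (1 / \<bar>s0\<bar>))
    \<in> O[at 0](\<lambda>_. 1)"
proof -
  let ?g = "escape_rate lam i j" and ?K = "ln (c\<^sup>2 / (1 - c\<^sup>2))"
  have rate: "0 < ?g"
    using assms(1) by (simp add: escape_rate_def eig_gap_def)
  have c: "0 < c\<^sup>2" "c\<^sup>2 < 1"
    using assms by (auto simp: power_less_one_iff)
  have "\<forall>\<^sub>F s0 in at (0::real). escape_time lam i j c s0 - 1 / ?g * ln (1 / \<bar>s0\<bar>)
      = 1 / (2 * ?g) * (?K + ln (1 - s0\<^sup>2))"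
    unfolding eventually_at
  proof (intro exI[of _ c] conjI ballI impI)
    fix s0 :: real assume "s0 \<noteq> 0 \<and> dist s0 0 < c"
    then have s0: "0 < \<bar>s0\<bar>" "\<bar>s0\<bar> < c"
      by auto
    then have sq: "0 < s0\<^sup>2" "s0\<^sup>2 < 1"
      using assms(3) by (auto simp: abs_square_less_1)
    have "ln (s0\<^sup>2) = 2 * ln \<bar>s0\<bar>"
      using ln_realpow[of "\<bar>s0\<bar>" 2] by simp
    then have "ln (c\<^sup>2 * (1 - s0\<^sup>2) / (s0\<^sup>2 * (1 - c\<^sup>2))) = ?K + ln (1 - s0\<^sup>2) - 2 * ln \<bar>s0\<bar>"
      using c sq by (simp add: ln_mult ln_div)
    then have "escape_time lam i j c s0 = 1 / (2 * ?g) * (?K + ln (1 - s0\<^sup>2) - 2 * ln \<bar>s0\<bar>)"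
      using escape_time_eq[OF assms(1) s0 assms(3)] by simp
    moreover have "ln (1 / \<bar>s0\<bar>) = - ln \<bar>s0\<bar>"
      using s0 by (simp add: ln_div)
    moreover have "1 / (2 * ?g) * (a - 2 * b) - 1 / ?g * - b = 1 / (2 * ?g) * a" for a b
      using rate by (simp add: field_simps)
    ultimately show "escape_time lam i j c s0 - 1 / ?g * ln (1 / \<bar>s0\<bar>)
        = 1 / (2 * ?g) * (?K + ln (1 - s0\<^sup>2))"
      by (simp only:)
  qed (rule assms(2))
  moreover have "((\<lambda>s0::real. 1 / (2 * ?g) * (?K + ln (1 - s0\<^sup>2))) \<longlongrightarrow>
      1 / (2 * ?g) * (?K + ln (1 - 0\<^sup>2))) (at 0)"
    by (intro tendsto_intros) auto
  ultimately have "((\<lambda>s0. escape_time lam i j c s0 - 1 / ?g * ln (1 / \<bar>s0\<bar>)) \<longlongrightarrow>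
      1 / (2 * ?g) * (?K + ln (1 - 0\<^sup>2))) (at 0)"
    by (simp only: tendsto_cong)
  then have "((\<lambda>s0. (escape_time lam i j c s0 - 1 / ?g * ln (1 / \<bar>s0\<bar>)) / 1) \<longlongrightarrow>
      1 / (2 * ?g) * (?K + ln (1 - 0\<^sup>2))) (at 0)"
    by (simp only: div_by_1)
  then show ?thesis
    by (rule bigoI_tendsto) simp
qed

theorem proposition6p3:
  fixes lam :: "complex ^ 'n" and i j :: 'n
  assumes "lam $ i \<noteq> lam $ j"
  shows
    "(\<forall>p. residual_trajectory lam p \<and> p 0 \<in> two_face i j \<longrightarrow>
        (\<forall>t\<ge>0. ((\<lambda>t. imbalance i j (p t)) has_real_derivative
            2 * (eig_gap lam i j)\<^sup>2 * imbalance i j (p t) * (1 - (imbalance i j (p t))\<^sup>2))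
          (at t within {0..}))) \<and>
     (\<forall>sstar::real. 0 < sstar \<and> sstar < 1 \<longrightarrow>
        (\<forall>s0. 0 < \<bar>s0\<bar> \<and> \<bar>s0\<bar> < sstar \<longrightarrow>
           (\<exists>p. face_trajectory lam i j s0 p) \<and>
           (\<forall>p. face_trajectory lam i j s0 p \<longrightarrow>
              first_reach_time (\<lambda>t. \<bar>imbalance i j (p t)\<bar>) sstar (escape_time lam i j sstar s0)) \<and>
           escape_time lam i j sstar s0 =
             1 / (2 * escape_rate lam i j) *
               ln (sstar\<^sup>2 * (1 - s0\<^sup>2) / (s0\<^sup>2 * (1 - sstar\<^sup>2)))) \<and>
        (\<lambda>s0. escape_time lam i j sstar s0 - 1 / escape_rate lam i j * ln (1 / \<bar>s0\<bar>))
          \<in> O[at 0](\<lambda>_. 1))"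
proof -
  have "i \<noteq> j"
    using assms by auto
  show ?thesis
    using imbalance_deriv[OF _ _ \<open>i \<noteq> j\<close>] face_trajectory_exists[OF \<open>i \<noteq> j\<close>]
      first_reach_time_iff[OF assms] escape_time_eq[OF assms] escape_time_asymptotics[OF assms]
    by (auto simp: escape_rate_def)
qed

end
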